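(* Let $X$ be a real locally convex Hausdorff topological vector space, $T$ a nonempty index set, $\emptyset\ne\mathcal U_t\subset X^*\times\mathbb R$ for each $t\in T$, $\mathscr V:=\bigcup_{t\in T}\mathcal U_t$, $\mathscr U:=\prod_{t\in T}\mathcal U_t$, and assume $\mathcal F:=\{x\in X:\langle x^*,x\rangle\le r\ \forall(x^*,r)\in\mathscr V\}\ne\emptyset$. The following statements are equivalent: (i) For all $(c,s)\in X^*\times\mathbb R$ such that $\inf_{x\in\mathcal F}\langle c,x\rangle>-\infty$, the next two assertions are equivalent: $\quad(\alpha)$ for every $x\in X$: $\ \big[\langle x^*,x\rangle\le r\ \ \forall(x^*,r)\in\mathscr V\big]\Longrightarrow\langle c,x\rangle\ge s$; $\quad(\gamma)$ there exist $\bar t\in T$ and $\bar\lambda\in\mathbb R_+^{(\mathscr U)}$ such that $\sum_{u\in\operatorname{supp}\bar\lambda}\bar\lambda_uu^1_{\bar t}=-c$ and $\sum_{u\in\operatorname{supp}\bar\lambda}\bar\lambda_uu^2_{\bar t}\le -s$. (ii) $\bigcup_{t\in T}\operatorname{co}\operatorname{cone}\big[\mathcal U_t\cup\{(0_{X^*},1)\}\big]$ is a convex and closed subset of $X^*\times\mathbb R$.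
   Context: $X^*$ is the topological dual of $X$ with the weak* topology; $X^*\times\mathbb R$ has the product topology. $u\in\mathscr U$ is written $u=(u_t)_{t\in T}$ with $u_t=(u_t^1,u_t^2)\in\mathcal U_t$. For a set $I$, $\mathbb R_+^{(I)}$ is the set of families $\lambda=(\lambda_i)_{i\in I}$ of nonnegative reals with finite support $\operatorname{supp}\lambda=\{i:\lambda_i\ne0\}$; empty sums are zero. $\operatorname{cone}B=\{\lambda b:\lambda\ge0,b\in B\}$, $\operatorname{co}$ is the convex hull. *)

theory Defs
  imports "HOL-Analysis.Analysis"
begin

section \<open>Locally convex Hausdorff spaces\<close>

text \<open>
  The third conjunct below is \<^term>\<open>convex C\<close> written out: the constant itself
  cannot be used inside a class specification (see \<open>convex_nhd_zero\<close>).
\<close>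

class locally_convex_space = real_vector + topological_ab_group_add + t2_space +
  assumes tendsto_scaleR_nhds:
      "((\<lambda>p. fst p *\<^sub>R snd p) \<longlongrightarrow> a *\<^sub>R b) (nhds a \<times>\<^sub>F nhds b)"
    and open_convex_nhd_zero:
      "open N \<Longrightarrow> 0 \<in> N \<Longrightarrow>
       \<exists>C. open C \<and> 0 \<in> C \<and>
         (\<forall>x\<in>C. \<forall>y\<in>C. \<forall>u\<ge>0. \<forall>v\<ge>0. u + v = 1 \<longrightarrow> u *\<^sub>R x + v *\<^sub>R y \<in> C) \<and>
         C \<subseteq> N"

lemma convex_nhd_zero:
  fixes N :: "'a :: locally_convex_space set"
  assumes "open N" "0 \<in> N"
  shows "\<exists>C. open C \<and> 0 \<in> C \<and> convex C \<and> C \<subseteq> N"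
  using open_convex_nhd_zero[OF assms] by (simp add: convex_def)

instance real_normed_vector \<subseteq> locally_convex_space
proof
  fix a :: real and b :: 'a
  show "((\<lambda>p. fst p *\<^sub>R snd p) \<longlongrightarrow> a *\<^sub>R b) (nhds a \<times>\<^sub>F nhds b)"
    by (intro tendsto_scaleR filterlim_fst filterlim_snd)
next
  fix N :: "'a set"
  assume "open N" "0 \<in> N"
  then obtain e where "e > 0" "ball 0 e \<subseteq> N"
    using open_contains_ball by blast
  then show "\<exists>C. open C \<and> 0 \<in> C \<and>
      (\<forall>x\<in>C. \<forall>y\<in>C. \<forall>u\<ge>0. \<forall>v\<ge>0. u + v = 1 \<longrightarrow> u *\<^sub>R x + v *\<^sub>R y \<in> C) \<and> C \<subseteq> N"
    using convex_ball[of "0 :: 'a" e] by (intro exI[of _ "ball 0 e"]) (simp add: convex_def)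
qed


section \<open>The topological dual with the weak* topology\<close>

typedef (overloaded) ('a :: locally_convex_space) weak_dual =
    "{f :: 'a \<Rightarrow> real. linear f \<and> continuous_on UNIV f}"
  morphisms pairing Abs_weak_dual
  by (rule exI[of _ "\<lambda>_. 0"]) (simp add: linear_iff)

notation pairing ("\<langle>_, _\<rangle>")

setup_lifting type_definition_weak_dual

instantiation weak_dual :: (locally_convex_space) real_vector
begin

lift_definition zero_weak_dual :: "'a weak_dual" is "\<lambda>_. 0"
  by (simp add: linear_iff)

lift_definition uminus_weak_dual :: "'a weak_dual \<Rightarrow> 'a weak_dual" is "\<lambda>f x. - f x"
  by (auto simp: linear_iff intro: continuous_intros)

lift_definition plus_weak_dual :: "'a weak_dual \<Rightarrow> 'a weak_dual \<Rightarrow> 'a weak_dual"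
  is "\<lambda>f g x. f x + g x"
  by (auto simp: linear_iff algebra_simps intro: continuous_intros)

lift_definition minus_weak_dual :: "'a weak_dual \<Rightarrow> 'a weak_dual \<Rightarrow> 'a weak_dual"
  is "\<lambda>f g x. f x - g x"
  by (auto simp: linear_iff algebra_simps intro: continuous_intros)

lift_definition scaleR_weak_dual :: "real \<Rightarrow> 'a weak_dual \<Rightarrow> 'a weak_dual"
  is "\<lambda>r f x. r * f x"
  by (auto simp: linear_iff algebra_simps intro: continuous_intros)

instance
  by standard (transfer; auto simp: algebra_simps)+

end

text \<open>
  The weak* topology is the coarsest topology for which all evaluations are continuous.
  The product type then carries the product topology through the library instance.
\<close>

instantiation weak_dual :: (locally_convex_space) topological_space
begin

definition open_weak_dual :: "'a weak_dual set \<Rightarrow> bool" where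
  "open_weak_dual =
     generate_topology {(\<lambda>f. \<langle>f, x\<rangle>) -` W | (x :: 'a) (W :: real set). open W}"

instance
  by standard (auto simp: open_weak_dual_def intro: generate_topology.intros)

end


section \<open>Linear systems and finitely supported families\<close>

definition feasible_set :: "('a :: locally_convex_space weak_dual \<times> real) set \<Rightarrow> 'a set" where
  "feasible_set V = {x. \<forall>(f, r)\<in>V. \<langle>f, x\<rangle> \<le> r}"

text \<open>
  A family indexed by a set \<open>I\<close> is represented by a function on the whole type that
  vanishes outside \<open>I\<close>, so that its support is \<open>{i. l i \<noteq> 0}\<close>.
\<close>

definition supp :: "('i \<Rightarrow> real) \<Rightarrow> 'i set" where
  "supp l = {i. l i \<noteq> 0}"

definition nonneg_fin_supp :: "'i set \<Rightarrow> ('i \<Rightarrow> real) set" where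
  "nonneg_fin_supp I = {l. (\<forall>i. 0 \<le> l i) \<and> supp l \<subseteq> I \<and> finite (supp l)}"

end

theory Submission
  imports Defs
begin

text \<open>
  Let \<open>M\<close> be the union of the cones and \<open>A\<close> the set of all affine inequalities
  \<open>\<langle>f, x\<rangle> \<le> r\<close> valid on the feasible set. The primal assertion says \<open>(- c, - s) \<in> A\<close>,
  the dual one \<open>(- c, - s) \<in> M\<close>, and \<open>M \<subseteq> A\<close>, so the equivalence for all \<open>(c, s)\<close> means
  \<open>M = A\<close>; pairs with infimum \<open>-\<infinity>\<close> lie in neither set. As \<open>A\<close> is a closed convex cone, it
  remains to see that \<open>A \<subseteq> M\<close> when \<open>M\<close> is closed and convex. This is Farkas' lemma: a weak*
  neighbourhood involves only finitely many points of the space, so a point outside \<open>M\<close> is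
  separated from \<open>M\<close> already in a finite-dimensional quotient, where a nearest-point argument
  applies.
\<close>

section \<open>Separation in finite dimensions by a nearest-point argument\<close>

text \<open>Dividing by \<open>t\<close> and letting \<open>t\<close> decrease to 0 removes the
  quadratic term. This yields the first-order optimality condition at the nearest point.\<close>

lemma nonneg_if_quadratic_nonneg_near_0:
  fixes b q :: real
  assumes "\<And>t. 0 < t \<Longrightarrow> t \<le> 1 \<Longrightarrow> 0 \<le> t * b + t\<^sup>2 * q"
  shows "0 \<le> b"
proof -
  have "((\<lambda>t. b + t * q) \<longlongrightarrow> b + 0 * q) (at_right 0)"
    by (intro tendsto_intros)
  moreover have "eventually (\<lambda>t. 0 \<le> b + t * q) (at_right 0)"
  proof (rule eventually_at_rightI[of 0 1])
    fix t :: real assume t: "t \<in> {0<..<1}"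
    have "0 \<le> t * (b + t * q)"
      using assms[of t] t by (simp add: algebra_simps power2_eq_square)
    then show "0 \<le> b + t * q"
      using t by (simp add: zero_le_mult_iff)
  qed simp
  ultimately have "0 \<le> b + 0 * q"
    by (intro tendsto_lowerbound) auto
  then show ?thesis by simp
qed

text \<open>
  Separation from the origin in the finite-dimensional image of \<open>C\<close> under the functionals
  \<open>\<phi> i\<close>; the vector \<open>y\<close> is the point of least Euclidean norm in the closure of that image.
\<close>

lemma separate_from_zero_by_finitely_many_functionals:
  fixes \<phi> :: "'i \<Rightarrow> 'b :: real_vector \<Rightarrow> real"
  assumes fin: "finite I" and lin: "\<And>i. linear (\<phi> i)"
    and C: "convex C" "C \<noteq> {}"
    and away: "\<And>x. x \<in> C \<Longrightarrow> \<delta> \<le> (\<Sum>i\<in>I. (\<phi> i x)\<^sup>2)"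
  obtains y where "\<And>x. x \<in> C \<Longrightarrow> \<delta> \<le> (\<Sum>i\<in>I. y i * \<phi> i x)"
proof -
  define N where "N x = (\<Sum>i\<in>I. (\<phi> i x)\<^sup>2)" for x
  define d where "d = (INF x\<in>C. N x)"
  have bdd: "bdd_below (N ` C)"
    using away by (auto simp: N_def intro!: bdd_belowI[of _ \<delta>])
  have d_le: "d \<le> N x" if "x \<in> C" for x
    unfolding d_def by (rule cINF_lower[OF bdd that])
  have d_ge: "\<delta> \<le> d"
    unfolding d_def using C(2) away by (intro cINF_greatest) (auto simp: N_def)
  \<comment> \<open>The infimum \<open>d\<close> need not be attained on \<open>C\<close>, so a
    minimizing sequence \<open>X\<close> stands in for a minimizer.\<close>
  have "\<exists>x\<in>C. N x < d + inverse (real (Suc k))" for k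
  proof -
    have "(INF x\<in>C. N x) < d + inverse (real (Suc k))" by (simp add: d_def)
    then show ?thesis using cINF_less_iff[OF C(2) bdd] by blast
  qed
  then obtain X where XC: "\<And>k. X k \<in> C" and XN: "\<And>k. N (X k) < d + inverse (real (Suc k))"
    by metis
  note \<phi>_simps = linear_add[OF lin] linear_diff[OF lin] linear_scale[OF lin]
  \<comment> \<open>Parallelogram identity: the midpoint of \<open>X k\<close> and
    \<open>X l\<close> lies in \<open>C\<close>, so its value of \<open>N\<close> is at least
    \<open>d\<close>, which leaves little room for the difference.\<close>
  have close: "N (X k - X l) \<le> 2 * (inverse (real (Suc k)) + inverse (real (Suc l)))" for k l
  proof -
    let ?m = "(1/2) *\<^sub>R X k + (1/2) *\<^sub>R X l"
    have "N (X k - X l) = 2 * N (X k) + 2 * N (X l) - 4 * N ?m"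
      by (simp add: N_def \<phi>_simps sum_distrib_left power2_eq_square algebra_simps
          flip: sum.distrib sum_subtractf)
    moreover have "?m \<in> C"
      using C(1) XC by (intro convexD) auto
    ultimately show ?thesis
      using d_le[of ?m] XN[of k] XN[of l] by simp
  qed
  \<comment> \<open>Each squared coordinate is bounded by \<open>N\<close>, so the images converge
    coordinatewise. The limit \<open>y\<close> need not be the image of a point of
    \<open>C\<close>.\<close>
  have "Cauchy (\<lambda>k. \<phi> i (X k))" if i: "i \<in> I" for i
  proof (rule metric_CauchyI)
    fix e :: real assume e: "0 < e"
    have "(\<lambda>k. inverse (real (Suc k))) \<longlonglongrightarrow> 0"
      by (rule LIMSEQ_inverse_real_of_nat)
    then have "eventually (\<lambda>k. inverse (real (Suc k)) < e\<^sup>2 / 4) sequentially"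
      using e by (intro order_tendstoD) auto
    then obtain M where M: "\<And>k. k \<ge> M \<Longrightarrow> inverse (real (Suc k)) < e\<^sup>2 / 4"
      by (auto simp: eventually_sequentially)
    show "\<exists>M. \<forall>m\<ge>M. \<forall>n\<ge>M. dist (\<phi> i (X m)) (\<phi> i (X n)) < e"
    proof (intro exI allI impI)
      fix m n assume mn: "M \<le> m" "M \<le> n"
      have "(\<phi> i (X m) - \<phi> i (X n))\<^sup>2 \<le> N (X m - X n)"
        unfolding N_def \<phi>_simps[symmetric] using fin i by (intro member_le_sum) auto
      also have "\<dots> \<le> 2 * (inverse (real (Suc m)) + inverse (real (Suc n)))" by (rule close)
      also have "\<dots> < e\<^sup>2" using M[OF mn(1)] M[OF mn(2)] by simp
      finally have "\<bar>\<phi> i (X m) - \<phi> i (X n)\<bar> < e"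
        using e by (metis abs_le_square_iff abs_of_pos not_le)
      then show "dist (\<phi> i (X m)) (\<phi> i (X n)) < e" by (simp add: dist_real_def)
    qed
  qed
  then have "\<forall>i\<in>I. \<exists>z. (\<lambda>k. \<phi> i (X k)) \<longlonglongrightarrow> z"
    by (meson Cauchy_convergent convergent_def)
  then obtain y where y: "\<And>i. i \<in> I \<Longrightarrow> (\<lambda>k. \<phi> i (X k)) \<longlonglongrightarrow> y i"
    by metis
  have "(\<lambda>k. N (X k)) \<longlonglongrightarrow> (\<Sum>i\<in>I. (y i)\<^sup>2)"
    unfolding N_def by (intro tendsto_intros y)
  moreover have "(\<lambda>k. N (X k)) \<longlonglongrightarrow> d"
  proof (rule tendsto_sandwich[of "\<lambda>_. d" _ _ "\<lambda>k. d + inverse (real (Suc k))"])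
    show "(\<lambda>k. d + inverse (real (Suc k))) \<longlonglongrightarrow> d"
      by (rule LIMSEQ_inverse_real_of_nat_add)
    show "eventually (\<lambda>k. d \<le> N (X k)) sequentially"
      using d_le XC by simp
    show "eventually (\<lambda>k. N (X k) \<le> d + inverse (real (Suc k))) sequentially"
      using XN by (intro always_eventually allI less_imp_le)
  qed simp
  ultimately have y_norm: "(\<Sum>i\<in>I. (y i)\<^sup>2) = d"
    by (rule LIMSEQ_unique)
  have "\<delta> \<le> (\<Sum>i\<in>I. y i * \<phi> i x)" if x: "x \<in> C" for x
  proof -
    \<comment> \<open>The point at parameter \<open>t\<close> on the segment from \<open>y\<close>
      to the image of \<open>x\<close> is a limit of images of convex combinations of
      \<open>X k\<close> and \<open>x\<close>, so its squared norm is at least \<open>d\<close>.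
      Expanding the square gives this quadratic in \<open>t\<close>.\<close>
    have "0 \<le> t * (2 * (\<Sum>i\<in>I. y i * (\<phi> i x - y i))) + t\<^sup>2 * (\<Sum>i\<in>I. (\<phi> i x - y i)\<^sup>2)"
      if t: "0 < t" "t \<le> 1" for t
    proof -
      have "d \<le> (\<Sum>i\<in>I. (\<phi> i (X k) + t * (\<phi> i x - \<phi> i (X k)))\<^sup>2)" for k
      proof -
        have "(1 - t) *\<^sub>R X k + t *\<^sub>R x \<in> C"
          using C(1) XC x t by (intro convexD) auto
        then have "d \<le> N ((1 - t) *\<^sub>R X k + t *\<^sub>R x)" by (rule d_le)
        then show ?thesis by (simp add: N_def \<phi>_simps algebra_simps)
      qed
      moreover have "(\<lambda>k. \<Sum>i\<in>I. (\<phi> i (X k) + t * (\<phi> i x - \<phi> i (X k)))\<^sup>2)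
          \<longlonglongrightarrow> (\<Sum>i\<in>I. (y i + t * (\<phi> i x - y i))\<^sup>2)"
        by (intro tendsto_intros y)
      ultimately have "d \<le> (\<Sum>i\<in>I. (y i + t * (\<phi> i x - y i))\<^sup>2)"
        by (intro tendsto_lowerbound) auto
      also have "\<dots> = (\<Sum>i\<in>I. (y i)\<^sup>2) + t * (2 * (\<Sum>i\<in>I. y i * (\<phi> i x - y i)))
          + t\<^sup>2 * (\<Sum>i\<in>I. (\<phi> i x - y i)\<^sup>2)"
        by (simp add: sum_distrib_left power2_eq_square algebra_simps
            flip: sum.distrib sum_subtractf)
      finally show ?thesis by (simp add: y_norm)
    qed
    then have "0 \<le> 2 * (\<Sum>i\<in>I. y i * (\<phi> i x - y i))"
      by (rule nonneg_if_quadratic_nonneg_near_0)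
    also have "(\<Sum>i\<in>I. y i * (\<phi> i x - y i)) = (\<Sum>i\<in>I. y i * \<phi> i x) - d"
      by (simp add: y_norm[symmetric] power2_eq_square algebra_simps sum_subtractf)
    finally show ?thesis using d_ge by simp
  qed
  then show ?thesis by (rule that)
qed

section \<open>The pairing and basic weak* neighbourhoods\<close>

lemma pairing_add_left [simp]: "\<langle>f + g, x\<rangle> = \<langle>f, x\<rangle> + \<langle>g, x\<rangle>"
  by transfer simp

lemma pairing_scaleR_left [simp]: "\<langle>a *\<^sub>R f, x\<rangle> = a * \<langle>f, x\<rangle>"
  by transfer simp

lemma pairing_zero_left [simp]: "\<langle>0, x\<rangle> = 0"
  by transfer simp

lemma pairing_uminus_left [simp]: "\<langle>- f, x\<rangle> = - \<langle>f, x\<rangle>"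
  by transfer simp

lemma linear_pairing: "linear (pairing f)"
  using pairing[of f] by simp

lemmas pairing_add_right = linear_add[OF linear_pairing]
lemmas pairing_scaleR_right = linear_scale[OF linear_pairing]
lemmas pairing_sum_right = linear_sum[OF linear_pairing]

lemma continuous_on_pairing: "continuous_on UNIV (\<lambda>f. \<langle>f, x\<rangle>)"
proof -
  have "open ((\<lambda>f. \<langle>f, x\<rangle>) -` W)" if "open W" for W
    unfolding open_weak_dual_def using that by (intro generate_topology.Basis) blast
  then show ?thesis by (simp add: continuous_on_open_vimage)
qed

text \<open>Induction on the generation of the topology: a subbasic set involves one point, an
  intersection takes the union of the point sets and the smaller radius, and a union inherits from
  one member. Finiteness of \<open>J\<close> is what reduces separation to finite
  dimensions.\<close>

lemma open_weak_dual_nhd: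
  fixes S :: "'a :: locally_convex_space weak_dual set"
  assumes "open S" "f \<in> S"
  shows "\<exists>J \<epsilon>. finite J \<and> 0 < \<epsilon> \<and> {g. \<forall>x\<in>J. \<bar>\<langle>g, x\<rangle> - \<langle>f, x\<rangle>\<bar> < \<epsilon>} \<subseteq> S"
  using assms unfolding open_weak_dual_def
proof (induction arbitrary: f rule: generate_topology.induct)
  case UNIV
  show ?case by (intro exI[of _ "{}"] exI[of _ 1]) auto
next
  case (Int A B)
  obtain J \<epsilon> where 1: "finite J" "0 < \<epsilon>" "{g. \<forall>x\<in>J. \<bar>\<langle>g, x\<rangle> - \<langle>f, x\<rangle>\<bar> < \<epsilon>} \<subseteq> A"
    using Int.IH(1)[of f] Int.prems by blast
  obtain K \<epsilon>' where 2: "finite K" "0 < \<epsilon>'" "{g. \<forall>x\<in>K. \<bar>\<langle>g, x\<rangle> - \<langle>f, x\<rangle>\<bar> < \<epsilon>'} \<subseteq> B"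
    using Int.IH(2)[of f] Int.prems by blast
  show ?case
  proof (intro exI[of _ "J \<union> K"] exI[of _ "min \<epsilon> \<epsilon>'"] conjI)
    show "{g. \<forall>x\<in>J \<union> K. \<bar>\<langle>g, x\<rangle> - \<langle>f, x\<rangle>\<bar> < min \<epsilon> \<epsilon>'} \<subseteq> A \<inter> B"
      using 1(3) 2(3) by (auto simp: subset_iff)
  qed (use 1 2 in auto)
next
  case (UN K)
  then obtain A where A: "A \<in> K" "f \<in> A" by blast
  show ?case using UN.IH[OF A] A(1) by (meson Union_upper order_trans)
next
  case (Basis A)
  then obtain x W where A: "A = (\<lambda>f. \<langle>f, x\<rangle>) -` W" "open W" by blast
  then obtain e where "0 < e" "\<forall>y. dist y \<langle>f, x\<rangle> < e \<longrightarrow> y \<in> W"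
    using Basis.prems open_dist by (metis vimageE)
  then show ?case
    using A by (intro exI[of _ "{x}"] exI[of _ e]) (auto simp: dist_real_def)
qed

section \<open>Separation from a weak* closed convex cone\<close>

lemma weak_dual_separate_cone:
  fixes M :: "('a :: locally_convex_space weak_dual \<times> real) set"
  assumes M: "convex M" "cone M" "closed M" "M \<noteq> {}" and p: "(c, s) \<notin> M"
  obtains z \<beta> where "\<And>f r. (f, r) \<in> M \<Longrightarrow> \<langle>f, z\<rangle> + \<beta> * r \<le> 0" "0 < \<langle>c, z\<rangle> + \<beta> * s"
proof -
  have "open (- M)" "(c, s) \<in> - M" using M p by auto
  then obtain A B where AB: "open A" "open B" "c \<in> A" "s \<in> B" "A \<times> B \<subseteq> - M"
    by (metis open_prod_elim mem_Sigma_iff)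
  obtain J \<epsilon> where J: "finite J" "0 < \<epsilon>" "{g. \<forall>x\<in>J. \<bar>\<langle>g, x\<rangle> - \<langle>c, x\<rangle>\<bar> < \<epsilon>} \<subseteq> A"
    using open_weak_dual_nhd[OF AB(1,3)] by blast
  obtain \<epsilon>' where e': "0 < \<epsilon>'" "\<And>r. \<bar>r - s\<bar> < \<epsilon>' \<Longrightarrow> r \<in> B"
    using AB(2,4) by (metis open_real)
  define \<eta> where "\<eta> = min \<epsilon> \<epsilon>'"
  have \<eta>: "0 < \<eta>" using J e' by (simp add: \<eta>_def)
  \<comment> \<open>The index \<open>None\<close> stands for the real coordinate,
    \<open>Some x\<close> for evaluation at \<open>x\<close>.\<close>
  define \<phi> :: "'a option \<Rightarrow> 'a weak_dual \<times> real \<Rightarrow> real"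
    where "\<phi> i q = (case i of None \<Rightarrow> snd q | Some x \<Rightarrow> \<langle>fst q, x\<rangle>)" for i q
  define I where "I = insert None (Some ` J)"
  \<comment> \<open>Separating \<open>C\<close> from the origin amounts to separating
    \<open>(c, s)\<close> from \<open>M\<close>.\<close>
  define C where "C = (\<lambda>m. (c, s) - m) ` M"
  have finI: "finite I" using J by (simp add: I_def)
  have lin: "linear (\<phi> i)" for i
    by (rule linearI) (auto simp: \<phi>_def split: option.split)
  have "C = (+) (c, s) ` uminus ` M" by (auto simp: C_def image_image)
  then have C: "convex C" "C \<noteq> {}"
    using M by (auto simp del: add_Pair intro!: convex_translation convex_negations)
  have "\<eta>\<^sup>2 \<le> (\<Sum>i\<in>I. (\<phi> i x)\<^sup>2)" if x: "x \<in> C" for x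
  proof -
    obtain f r where fr: "(f, r) \<in> M" "x = (c, s) - (f, r)" using x by (auto simp: C_def)
    \<comment> \<open>If all coordinates of the difference were below \<eta>, the point
      \<open>(f, r)\<close> of \<open>M\<close> would lie in the neighbourhood
      \<open>A \<times> B\<close>, which misses \<open>M\<close>.\<close>
    have "\<exists>i\<in>I. \<eta> \<le> \<bar>\<phi> i x\<bar>"
    proof (rule ccontr)
      assume neg: "\<not> ?thesis"
      have \<phi>x: "\<phi> None x = s - r" "\<phi> (Some v) x = \<langle>c, v\<rangle> - \<langle>f, v\<rangle>" for v
        using fr(2) linear_diff[OF lin] by (simp_all add: \<phi>_def minus_weak_dual.rep_eq)
      have "f \<in> A" using neg J(3) by (force simp: I_def \<phi>x \<eta>_def abs_minus_commute)
      moreover have "r \<in> B" using neg e'(2) by (force simp: I_def \<phi>x \<eta>_def abs_minus_commute)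
      ultimately show False using AB(5) fr(1) by blast
    qed
    then obtain i where i: "i \<in> I" "\<eta> \<le> \<bar>\<phi> i x\<bar>" by blast
    have "\<eta>\<^sup>2 \<le> (\<phi> i x)\<^sup>2" using i(2) \<eta> by (metis abs_le_square_iff abs_of_pos)
    also have "\<dots> \<le> (\<Sum>i\<in>I. (\<phi> i x)\<^sup>2)" using finI i(1) by (intro member_le_sum) auto
    finally show ?thesis .
  qed
  then obtain y where y: "\<And>x. x \<in> C \<Longrightarrow> \<eta>\<^sup>2 \<le> (\<Sum>i\<in>I. y i * \<phi> i x)"
    using separate_from_zero_by_finitely_many_functionals[where \<phi> = \<phi> and \<delta> = "\<eta>\<^sup>2", OF finI lin C]
    by blast
  \<comment> \<open>A linear combination of evaluations is again an evaluation, at the same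
    combination of points. Hence the separating functional comes from a point \<open>z\<close> of
    the space and the coefficient \<open>y None\<close>.\<close>
  define z where "z = (\<Sum>x\<in>J. y (Some x) *\<^sub>R x)"
  have val: "(\<Sum>i\<in>I. y i * \<phi> i (f, r)) = \<langle>f, z\<rangle> + y None * r" for f r
    using J(1) by (simp add: I_def \<phi>_def z_def pairing_sum_right pairing_scaleR_right
        sum.reindex)
  have sep: "\<eta>\<^sup>2 + \<langle>f, z\<rangle> + y None * r \<le> \<langle>c, z\<rangle> + y None * s" if "(f, r) \<in> M" for f r
  proof -
    have "(c - f, s - r) \<in> C" using that by (force simp: C_def)
    from y[OF this] show ?thesis
      by (simp add: val minus_weak_dual.rep_eq algebra_simps)
  qed
  have sq: "0 < \<eta>\<^sup>2" using \<eta> by simp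
  show ?thesis
  proof
    have "(0, 0) \<in> M"
      using M(2,4) unfolding cone_def by (metis ex_in_conv order_refl scaleR_zero_left zero_prod_def)
    from sep[OF this] show "0 < \<langle>c, z\<rangle> + y None * s" using sq by (simp only: pairing_zero_left mult_zero_right)
  next
    fix f r assume fr: "(f, r) \<in> M"
    show "\<langle>f, z\<rangle> + y None * r \<le> 0"
    \<comment> \<open>A positive value at \<open>(f, r)\<close> would grow without bound along its
      ray in the cone, contradicting the bound \<open>sep\<close>.\<close>
    proof (rule ccontr)
      assume "\<not> ?thesis"
      then have pos: "0 < \<langle>f, z\<rangle> + y None * r" by simp
      obtain n :: nat where n: "\<langle>c, z\<rangle> + y None * s < real n * (\<langle>f, z\<rangle> + y None * r)"
        using reals_Archimedean3[OF pos] by blast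
      have "real n *\<^sub>R (f, r) \<in> M" using M(2) fr by (simp add: mem_cone del: scaleR_Pair)
      then show False using sep[of "real n *\<^sub>R f" "real n * r"] n sq by (simp add: algebra_simps)
    qed
  qed
qed

section \<open>Consequences of the system and Farkas' lemma\<close>

definition consequence_set :: "('a :: locally_convex_space weak_dual \<times> real) set \<Rightarrow> ('a weak_dual \<times> real) set"
  where "consequence_set V = {(f, r). \<forall>x\<in>feasible_set V. \<langle>f, x\<rangle> \<le> r}"

lemma subset_consequence_set: "V \<subseteq> consequence_set V"
  by (auto simp: consequence_set_def feasible_set_def)

lemma convex_cone_consequence_set: "convex (consequence_set V) \<and> cone (consequence_set V)"
  unfolding convex_cone
  by (auto simp: consequence_set_def intro: add_mono mult_left_mono)

lemma closed_consequence_set: "closed (consequence_set V)"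
proof -
  have "consequence_set V = (\<Inter>x\<in>feasible_set V. {q. \<langle>fst q, x\<rangle> \<le> snd q})"
    by (auto simp: consequence_set_def)
  moreover have "closed {q :: 'a weak_dual \<times> real. \<langle>fst q, x\<rangle> \<le> snd q}" for x
    by (intro closed_Collect_le continuous_on_snd continuous_on_id
        continuous_on_compose2[OF continuous_on_pairing continuous_on_fst[OF continuous_on_id]]) auto
  ultimately show ?thesis by auto
qed

text \<open>A pair \<open>(z, \<beta>)\<close> separating a consequence from \<open>M\<close> would
  produce a feasible point violating that consequence. Since \<open>(0, 1)\<close> lies in
  \<open>M\<close>, \<beta> is at most 0: if it is negative, a positive multiple of \<open>z\<close>
  is such a point; if it is 0, \<open>z\<close> is a recession direction of the feasible set along
  which \<open>c\<close> is unbounded above.\<close>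

lemma consequence_set_minimal:
  assumes M: "convex M" "cone M" "closed M" "V \<subseteq> M" "(0, 1) \<in> M"
    and ne: "feasible_set V \<noteq> {}"
  shows "consequence_set V \<subseteq> M"
proof (rule ccontr)
  assume "\<not> ?thesis"
  then obtain c s where cs: "(c, s) \<in> consequence_set V" "(c, s) \<notin> M" by auto
  obtain z \<beta> where sep: "\<And>f r. (f, r) \<in> M \<Longrightarrow> \<langle>f, z\<rangle> + \<beta> * r \<le> 0" "0 < \<langle>c, z\<rangle> + \<beta> * s"
    using weak_dual_separate_cone[OF M(1-3) _ cs(2)] M(5) by blast
  have c: "\<langle>c, x\<rangle> \<le> s" if "x \<in> feasible_set V" for x
    using cs(1) that by (auto simp: consequence_set_def)
  have "\<beta> \<le> 0" using sep(1)[OF M(5)] by simp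
  then consider "\<beta> < 0" | "\<beta> = 0" by linarith
  then show False
  proof cases
    case 1
    \<comment> \<open>Scaling by \<open>k\<close> normalizes the coefficient \<beta> of
      \<open>r\<close> to -1.\<close>
    define k where "k = - inverse \<beta>"
    have k: "0 < k" "k * (\<beta> * r) = - r" for r
      using 1 by (auto simp: k_def)
    have scaled: "k * (\<langle>f, z\<rangle> + \<beta> * r) = \<langle>f, k *\<^sub>R z\<rangle> - r" for f r
      by (simp add: k(2) distrib_left pairing_scaleR_right)
    have "\<langle>f, k *\<^sub>R z\<rangle> \<le> r" if "(f, r) \<in> V" for f r
    proof -
      have "k * (\<langle>f, z\<rangle> + \<beta> * r) \<le> 0"
        using k(1) sep(1)[of f r] M(4) that by (intro mult_nonneg_nonpos) auto
      then show ?thesis by (simp add: scaled)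
    qed
    then have "k *\<^sub>R z \<in> feasible_set V"
      by (auto simp: feasible_set_def)
    from c[OF this] have "k * (\<langle>c, z\<rangle> + \<beta> * s) \<le> 0" by (simp add: scaled)
    then show False using mult_pos_pos[OF k(1) sep(2)] by simp
  next
    case 2
    obtain x where x: "x \<in> feasible_set V" using ne by blast
    obtain n :: nat where n: "s - \<langle>c, x\<rangle> < real n * \<langle>c, z\<rangle>"
      using reals_Archimedean3[of "\<langle>c, z\<rangle>"] sep(2) 2 by auto
    have "\<langle>f, x + real n *\<^sub>R z\<rangle> \<le> r" if fr: "(f, r) \<in> V" for f r
    proof -
      have "\<langle>f, z\<rangle> \<le> 0" using sep(1)[of f r] fr M(4) 2 by auto
      then have "real n * \<langle>f, z\<rangle> \<le> 0" by (simp add: mult_nonneg_nonpos)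
      moreover have "\<langle>f, x\<rangle> \<le> r" using x fr by (auto simp: feasible_set_def)
      ultimately show ?thesis by (simp add: pairing_add_right pairing_scaleR_right)
    qed
    then have "x + real n *\<^sub>R z \<in> feasible_set V" by (auto simp: feasible_set_def)
    from c[OF this] show False using n by (simp add: pairing_add_right pairing_scaleR_right)
  qed
qed

section \<open>Finitely supported families and the cones they generate\<close>

text \<open>Adding or scaling families changes their supports; the sums are compared over a common
  finite superset.\<close>

lemma sum_supp_superset:
  assumes "finite S" "supp l \<subseteq> S" "\<And>u. l u = 0 \<Longrightarrow> g u = 0"
  shows "sum g (supp l) = sum g S"
  using assms by (intro sum.mono_neutral_left) (auto simp: supp_def)

lemma supp_add_subset: "supp (\<lambda>u. l u + m u) \<subseteq> supp l \<union> supp m"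
  by (auto simp: supp_def)

lemma sum_supp_add:
  fixes g :: "'i \<Rightarrow> 'c :: real_vector"
  assumes "finite (supp l)" "finite (supp m)"
  shows "(\<Sum>u\<in>supp (\<lambda>u. l u + m u). (l u + m u) *\<^sub>R g u) =
    (\<Sum>u\<in>supp l. l u *\<^sub>R g u) + (\<Sum>u\<in>supp m. m u *\<^sub>R g u)"
proof -
  have fin: "finite (supp l \<union> supp m)" using assms by simp
  show ?thesis
    using sum_supp_superset[OF fin supp_add_subset, of "\<lambda>u. (l u + m u) *\<^sub>R g u"]
      sum_supp_superset[OF fin Un_upper1, of "\<lambda>u. l u *\<^sub>R g u"]
      sum_supp_superset[OF fin Un_upper2, of "\<lambda>u. m u *\<^sub>R g u"]
    by (simp add: scaleR_add_left sum.distrib)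
qed

text \<open>
  A family supported on the product \<open>Pi\<^sub>E T U\<close> only sees the coordinate \<open>t\<close>, and every
  element of \<open>U t\<close> is the \<open>t\<close>-coordinate of some member of the product, so such families
  generate the same cone as \<open>U t\<close>; the inequality absorbs the generator \<open>(0, 1)\<close>.
\<close>

lemma mem_convex_hull_cone_hull_iff:
  fixes U :: "'t \<Rightarrow> ('b :: real_vector \<times> real) set"
  assumes ne: "\<And>t. t \<in> T \<Longrightarrow> U t \<noteq> {}" and t: "t \<in> T"
  shows "(f, r) \<in> convex hull (cone hull (U t \<union> {(0, 1)})) \<longleftrightarrow>
    (\<exists>l \<in> nonneg_fin_supp (Pi\<^sub>E T U).
       (\<Sum>u\<in>supp l. l u *\<^sub>R fst (u t)) = f \<and> (\<Sum>u\<in>supp l. l u * snd (u t)) \<le> r)"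
    (is "_ \<in> ?K \<longleftrightarrow> ?R f r")
proof
  assume "?R f r"
  then obtain l where l: "l \<in> nonneg_fin_supp (Pi\<^sub>E T U)"
    "(\<Sum>u\<in>supp l. l u *\<^sub>R fst (u t)) = f" "(\<Sum>u\<in>supp l. l u * snd (u t)) \<le> r" by blast
  have K: "\<And>x y. x \<in> ?K \<Longrightarrow> y \<in> ?K \<Longrightarrow> x + y \<in> ?K"
    "\<And>x c. x \<in> ?K \<Longrightarrow> 0 \<le> c \<Longrightarrow> c *\<^sub>R x \<in> ?K"
    using convex_cone[of ?K] cone_convex_hull[OF cone_cone_hull] convex_convex_hull by blast+
  have gen: "x \<in> ?K" if "x \<in> U t \<union> {(0, 1)}" for x
    using that by (meson hull_inc)
  have fin: "finite (supp l)" and sub: "supp l \<subseteq> Pi\<^sub>E T U" and pos: "\<And>u. 0 \<le> l u"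
    using l(1) by (auto simp: nonneg_fin_supp_def)
  have zero: "0 \<in> ?K" using K(2)[OF gen, of "(0, 1)" 0] by (simp add: zero_prod_def)
  have "(\<Sum>u\<in>S. l u *\<^sub>R u t) \<in> ?K" if "finite S" "S \<subseteq> supp l" for S
    using that
  proof (induction S rule: finite_induct)
    case empty
    show ?case using zero by simp
  next
    case (insert u S)
    have "u t \<in> ?K" using gen[of "u t"] insert.prems sub t by (auto dest: PiE_mem)
    then show ?case using insert K pos by simp
  qed
  then have "(\<Sum>u\<in>supp l. l u *\<^sub>R u t) \<in> ?K" using fin by blast
  \<comment> \<open>The slack in the inequality is the coefficient of the generator
    \<open>(0, 1)\<close>.\<close>
  moreover have "(r - (\<Sum>u\<in>supp l. l u * snd (u t))) *\<^sub>R (0, 1) \<in> ?K"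
    using l(3) by (intro K(2) gen) simp_all
  ultimately have "(\<Sum>u\<in>supp l. l u *\<^sub>R u t) + (r - (\<Sum>u\<in>supp l. l u * snd (u t))) *\<^sub>R (0, 1) \<in> ?K"
    by (rule K(1))
  moreover have "(\<Sum>u\<in>supp l. l u *\<^sub>R u t) + (r - (\<Sum>u\<in>supp l. l u * snd (u t))) *\<^sub>R (0, 1) = (f, r)"
    using l(2) by (simp add: prod_eq_iff fst_sum snd_sum)
  ultimately show "(f, r) \<in> ?K" by simp
next
  \<comment> \<open>The representable pairs form a convex cone containing the generators, so
    minimality of the hull gives the inclusion.\<close>
  let ?G = "{(f, r). ?R f r}"
  have pair: "(x, y) \<in> ?G \<longleftrightarrow> ?R x y" for x y by simp
  have zero: "(0, 0) \<in> ?G" "(0, 1) \<in> ?G"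
    by (auto intro!: bexI[of _ "\<lambda>_. 0"] simp: nonneg_fin_supp_def supp_def)
  have scale: "a *\<^sub>R q \<in> ?G" if q: "q \<in> ?G" and a: "0 \<le> a" for a q
  proof -
    obtain x y where xy: "q = (x, y)" by (cases q)
    obtain l where l: "l \<in> nonneg_fin_supp (Pi\<^sub>E T U)"
      "(\<Sum>u\<in>supp l. l u *\<^sub>R fst (u t)) = x" "(\<Sum>u\<in>supp l. l u * snd (u t)) \<le> y"
      using q unfolding xy pair by blast
    let ?m = "\<lambda>u. a * l u"
    \<comment> \<open>Only an inclusion: for \<open>a = 0\<close> the support becomes empty.\<close>
    have sub: "supp ?m \<subseteq> supp l" by (auto simp: supp_def)
    have fin: "finite (supp l)" using l(1) by (simp add: nonneg_fin_supp_def)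
    have "?m \<in> nonneg_fin_supp (Pi\<^sub>E T U)"
      using l(1) a sub by (auto simp: nonneg_fin_supp_def intro: finite_subset)
    moreover have "(\<Sum>u\<in>supp ?m. ?m u *\<^sub>R fst (u t)) = a *\<^sub>R x"
      by (subst sum_supp_superset[OF fin sub]) (auto simp: scaleR_sum_right l(2)[symmetric])
    moreover have "(\<Sum>u\<in>supp ?m. ?m u * snd (u t)) = a * (\<Sum>u\<in>supp l. l u * snd (u t))"
      by (subst sum_supp_superset[OF fin sub]) (auto simp: sum_distrib_left mult.assoc)
    moreover have "a * (\<Sum>u\<in>supp l. l u * snd (u t)) \<le> a * y"
      using l(3) a by (rule mult_left_mono)
    ultimately have "?R (a *\<^sub>R x) (a * y)" by auto
    then show ?thesis by (simp add: xy)
  qed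
  have add: "q + q' \<in> ?G" if q: "q \<in> ?G" and q': "q' \<in> ?G" for q q'
  proof -
    obtain x y x' y' where xy: "q = (x, y)" "q' = (x', y')" by (cases q, cases q')
    obtain l where l: "l \<in> nonneg_fin_supp (Pi\<^sub>E T U)"
      "(\<Sum>u\<in>supp l. l u *\<^sub>R fst (u t)) = x" "(\<Sum>u\<in>supp l. l u * snd (u t)) \<le> y"
      using q unfolding xy pair by blast
    obtain m where m: "m \<in> nonneg_fin_supp (Pi\<^sub>E T U)"
      "(\<Sum>u\<in>supp m. m u *\<^sub>R fst (u t)) = x'" "(\<Sum>u\<in>supp m. m u * snd (u t)) \<le> y'"
      using q' unfolding xy pair by blast
    let ?n = "\<lambda>u. l u + m u"
    have fin: "finite (supp l)" "finite (supp m)"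
      using l(1) m(1) by (simp_all add: nonneg_fin_supp_def)
    have "supp l \<union> supp m \<subseteq> Pi\<^sub>E T U"
      using l(1) m(1) by (simp add: nonneg_fin_supp_def)
    with supp_add_subset have "supp ?n \<subseteq> Pi\<^sub>E T U"
      by (rule order_trans)
    moreover have "finite (supp ?n)"
      using finite_UnI[OF fin] by (rule finite_subset[OF supp_add_subset])
    ultimately have n: "?n \<in> nonneg_fin_supp (Pi\<^sub>E T U)"
      using l(1) m(1) by (simp add: nonneg_fin_supp_def)
    have "(\<Sum>u\<in>supp ?n. ?n u *\<^sub>R fst (u t)) = x + x'"
      by (simp only: sum_supp_add[OF fin] l(2) m(2))
    moreover have "(\<Sum>u\<in>supp ?n. ?n u * snd (u t)) \<le> y + y'"
      using add_mono[OF l(3) m(3)] sum_supp_add[OF fin, of "\<lambda>u. snd (u t)"]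
      by (simp only: real_scaleR_def)
    ultimately have "?R (x + x') (y + y')"
      by (intro bexI[OF _ n] conjI)
    then show ?thesis by (simp add: xy)
  qed
  have "U t \<subseteq> ?G"
  proof clarify
    fix x y assume xy: "(x, y) \<in> U t"
    \<comment> \<open>The given element is placed at coordinate \<open>t\<close> and arbitrary
      elements are chosen elsewhere; unit weight on this single \<open>u\<close> then represents
      \<open>(x, y)\<close>.\<close>
    define u where "u = (\<lambda>s\<in>T. if s = t then (x, y) else SOME v. v \<in> U s)"
    have u: "u \<in> Pi\<^sub>E T U" "u t = (x, y)"
      using ne xy t by (auto simp: u_def some_in_eq)
    let ?e = "\<lambda>v. if v = u then 1 else (0 :: real)"
    have supp: "supp ?e = {u}" by (auto simp: supp_def)
    have "?e \<in> nonneg_fin_supp (Pi\<^sub>E T U)"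
      using u(1) by (simp add: nonneg_fin_supp_def supp)
    then show "?R x y"
      by (rule bexI[rotated]) (simp add: supp u(2))
  qed
  then have gens: "U t \<union> {(0, 1)} \<subseteq> ?G"
    using zero(2) by (simp only: Un_subset_iff insert_subset empty_subsetI)
  have "convex ?G \<and> cone ?G"
    unfolding convex_cone by (intro conjI ballI allI impI add scale)
  then have "?K \<subseteq> ?G"
    by (intro hull_minimal gens) simp_all
  moreover assume "(f, r) \<in> ?K"
  ultimately have "(f, r) \<in> ?G" by (rule subsetD)
  then show "?R f r" by (simp only: pair)
qed

section \<open>Equivalence of the duality statement with convexity and closedness\<close>

theorem corollary5p2:
  fixes T :: "'t set"
    and U :: "'t \<Rightarrow> ('a :: locally_convex_space weak_dual \<times> real) set"
  assumes "T \<noteq> {}"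
    and "\<And>t. t \<in> T \<Longrightarrow> U t \<noteq> {}"
    and "feasible_set (\<Union>t\<in>T. U t) \<noteq> {}"
  shows
    "(\<forall>(c :: 'a weak_dual) (s :: real).
        (INF x \<in> feasible_set (\<Union>t\<in>T. U t). ereal \<langle>c, x\<rangle>) > -\<infinity> \<longrightarrow>
        ((\<forall>x :: 'a. (\<forall>(f, r) \<in> (\<Union>t\<in>T. U t). \<langle>f, x\<rangle> \<le> r) \<longrightarrow> \<langle>c, x\<rangle> \<ge> s)
         \<longleftrightarrow>
         (\<exists>t\<in>T. \<exists>l \<in> nonneg_fin_supp (Pi\<^sub>E T U).
            (\<Sum>u\<in>supp l. l u *\<^sub>R fst (u t)) = - c \<and>
            (\<Sum>u\<in>supp l. l u * snd (u t)) \<le> - s)))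
     \<longleftrightarrow>
     (convex (\<Union>t\<in>T. convex hull (cone hull (U t \<union> {(0, 1)}))) \<and>
      closed (\<Union>t\<in>T. convex hull (cone hull (U t \<union> {(0, 1)}))))"
proof -
  define V where "V = (\<Union>t\<in>T. U t)"
  define M where "M = (\<Union>t\<in>T. convex hull (cone hull (U t \<union> {(0, 1)})))"
  have A_convex: "convex (consequence_set V)" and A_cone: "cone (consequence_set V)"
    using convex_cone_consequence_set[of V] by auto
  have alpha: "(\<forall>x. (\<forall>(f, r) \<in> V. \<langle>f, x\<rangle> \<le> r) \<longrightarrow> \<langle>c, x\<rangle> \<ge> s) \<longleftrightarrow> (- c, - s) \<in> consequence_set V" for c s
    by (simp add: consequence_set_def feasible_set_def)
  have gamma: "(\<exists>t\<in>T. \<exists>l \<in> nonneg_fin_supp (Pi\<^sub>E T U).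
            (\<Sum>u\<in>supp l. l u *\<^sub>R fst (u t)) = - c \<and>
            (\<Sum>u\<in>supp l. l u * snd (u t)) \<le> - s) \<longleftrightarrow> (- c, - s) \<in> M" for c s
    unfolding M_def UN_iff using mem_convex_hull_cone_hull_iff[of T U, OF assms(2)] by simp
  have M_sub: "M \<subseteq> consequence_set V"
    unfolding M_def
  proof (intro UN_least hull_minimal)
    fix t assume "t \<in> T"
    then have "U t \<subseteq> consequence_set V" using subset_consequence_set[of V] by (auto simp: V_def)
    moreover have "(0, 1) \<in> consequence_set V" by (simp add: consequence_set_def)
    ultimately show "U t \<union> {(0, 1)} \<subseteq> consequence_set V" by simp
  qed (rule A_cone A_convex)+
  \<comment> \<open>For a consequence, \<open>s\<close> itself bounds the infimum from below, so the
    finiteness condition excludes no pair that matters when comparing the two sets.\<close>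
  have bounded: "(INF x\<in>feasible_set V. ereal \<langle>c, x\<rangle>) > - \<infinity>"
    if "(- c, - s) \<in> consequence_set V" for c s
  proof -
    have "ereal s \<le> (INF x\<in>feasible_set V. ereal \<langle>c, x\<rangle>)"
      using that by (intro INF_greatest) (auto simp: consequence_set_def)
    then show ?thesis using less_le_trans[of "- \<infinity>" "ereal s"] by simp
  qed
  \<comment> \<open>Unlike convexity, the cone property passes to the union, since a multiple stays
    in the hull for the same \<open>t\<close>.\<close>
  have "a *\<^sub>R q \<in> M" if q: "q \<in> M" and a: "0 \<le> a" for a q
  proof -
    obtain t where t: "t \<in> T" "q \<in> convex hull (cone hull (U t \<union> {(0, 1)}))"
      using q unfolding M_def by blast
    have "a *\<^sub>R q \<in> convex hull (cone hull (U t \<union> {(0, 1)}))"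
      by (rule mem_cone[OF cone_convex_hull[OF cone_cone_hull] t(2) a])
    with t(1) show ?thesis unfolding M_def by (rule UN_I)
  qed
  then have M_cone: "cone M" by (simp add: cone_def)
  have gen: "U t \<union> {(0, 1)} \<subseteq> M" if "t \<in> T" for t
  proof -
    have "U t \<union> {(0, 1)} \<subseteq> convex hull (cone hull (U t \<union> {(0, 1)}))"
      by (rule order_trans[OF hull_subset hull_subset])
    also have "\<dots> \<subseteq> M" using that by (auto simp: M_def)
    finally show ?thesis .
  qed
  have "V \<subseteq> M" "(0, 1) \<in> M" using gen assms(1) by (auto simp: V_def)
  then have "consequence_set V \<subseteq> M" if "convex M" "closed M"
    using consequence_set_minimal[OF that(1) M_cone that(2)] assms(3) by (simp add: V_def)
  then have "convex M \<and> closed M \<longleftrightarrow> M = consequence_set V"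
    using M_sub A_convex closed_consequence_set[of V] by (auto simp del: split_paired_All)
  moreover have "(\<forall>c s. (INF x \<in> feasible_set V. ereal \<langle>c, x\<rangle>) > - \<infinity> \<longrightarrow>
      ((- c, - s) \<in> consequence_set V \<longleftrightarrow> (- c, - s) \<in> M)) \<longleftrightarrow> M = consequence_set V" (is "?L \<longleftrightarrow> _")
  proof
    assume L: ?L
    \<comment> \<open>The assumption is applied to \<open>c = - f\<close> and
      \<open>s = - r\<close>.\<close>
    have "(f, r) \<in> M" if fr: "(f, r) \<in> consequence_set V" for f r
    proof -
      have "(- (- f), - (- r)) \<in> consequence_set V" using fr by simp
      then have "(- (- f), - (- r)) \<in> M" using L bounded by blast
      then show ?thesis by simp
    qed
    then show "M = consequence_set V" using M_sub by auto
  qed simp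
  ultimately show ?thesis
    unfolding V_def[symmetric] M_def[symmetric] alpha gamma by blast
qed

end
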